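(* Let $d$ be a degree, let $X$ be a Banach space, and let $\mathcal H$ be the set of subspaces of $X$ that are $d$-large. Then $\mathcal H$ is a D-family.
   Context: All Banach spaces are real; $X$ is infinite-dimensional. Every closed linear subspace of $X$ that is finite-dimensional is $d$-small, so $\mathcal H$ may be regarded as a set of infinite-dimensional closed subspaces. Degrees. An approximation pair is a pair $(X,F)$ where $X$ is a finite- or infinite-dimensional Banach space and $F$ is a finite-dimensional subspace of $X$. A morphism from $(X,F)$ to $(Y,G)$ is a pair $\varphi=(S,T)$ of bounded linear operators $S\colon G\to F$, $T\colon X\to Y$ such that $T(S(g))=g$ for all $g\in G$; its norm is $\|\varphi\|=\|S\|\cdot\|T\|$ if $G\neq\{0\}$ and $\|\varphi\|=1$ if $G=\{0\}$. A degree is a map $d$ assigning to every approximation pair $(X,F)$ a number $d(X,F)\in[0,\infty)$, for which there is a function $K_d\colon[1,\infty)\times[0,\infty)\to[0,\infty)$, non-decreasing in both variables, with $\lim_{s\to1}K_d(s,t)=t$ for all $t\ge 0$, such that $d(Y,G)\le K_d(\|\varphi\|,d(X,F))$ for every morphism $\varphi\colon(X,F)\to(Y,G)$. A space $X$ is $d$-small if $\sup_F d(X,F)<\infty$, the supremum being over all finite-dimensional subspaces $F$ of $X$, and $d$-large otherwise. D-families. $\mathrm{Sub}(X)$ is the set of all closed linear subspaces of $X$, finite- or infinite-dimensional. For $Y\in\mathrm{Sub}(X)$, $F\subseteq Y$ finite-dimensional and $\varepsilon>0$, let $[F,Y]_\varepsilon$ be the set of $Z\in\mathrm{Sub}(X)$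 for which there exist $Z'\in\mathrm{Sub}(X)$ with $F\subseteq Z'\subseteq Y$ and an isomorphism $T\colon Z'\to Z$ with $\|T-\mathrm{Id}_{Z'}\|<\varepsilon$. These sets form a basis of a topology on $\mathrm{Sub}(X)$, the Ellentuck topology. A D-family of subspaces of $X$ is a set $\mathcal H$ of infinite-dimensional closed subspaces of $X$ that is $G_\delta$ in $\mathrm{Sub}(X)$ for the Ellentuck topology and such that for every infinite-dimensional closed subspace $Y$ and every finite-dimensional subspace $F$ of $X$, $Y\in\mathcal H\iff Y+F\in\mathcal H$. *)

theory Defs
  imports "HOL-Analysis.Analysis"
begin

section \<open>Real Banach spaces inside a real vector space\<close>

text \<open>
  A degree is defined on all Banach spaces, so norm and underlying set have to be data, not fixed by
  a type. A normed space is given here by a linear subspace \<open>V\<close> of an arbitrary real vector space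
  \<open>'u\<close>, which only serves as a universe, and a function \<open>N\<close> whose values on \<open>V\<close> are the norm. The
  values of \<open>N\<close> off \<open>V\<close> are irrelevant: no definition below looks at them, except that a degree,
  being a function of \<open>V\<close> and \<open>N\<close>, could formally depend on them; it does not, as one sees from the
  identity morphism. A subspace of \<open>(V, N)\<close> carries the same \<open>N\<close>.
\<close>

text \<open>The locale \<open>Metric_space\<close> wants a distance that is nonnegative and symmetric everywhere.\<close>

definition norm_dist :: "'u::real_vector set \<Rightarrow> ('u \<Rightarrow> real) \<Rightarrow> 'u \<Rightarrow> 'u \<Rightarrow> real" where
  "norm_dist V N x y = (if x \<in> V \<and> y \<in> V then N (x - y) else 0)"

definition normed_space_on :: "'u::real_vector set \<Rightarrow> ('u \<Rightarrow> real) \<Rightarrow> bool" where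
  "normed_space_on V N \<longleftrightarrow>
     subspace V \<and>
     (\<forall>x\<in>V. 0 \<le> N x \<and> (N x = 0 \<longleftrightarrow> x = 0)) \<and>
     (\<forall>x\<in>V. \<forall>c. N (c *\<^sub>R x) = \<bar>c\<bar> * N x) \<and>
     (\<forall>x\<in>V. \<forall>y\<in>V. N (x + y) \<le> N x + N y)"

lemma Metric_space_norm_dist:
  assumes "normed_space_on V N"
  shows "Metric_space V (norm_dist V N)"
proof
  have sub: "subspace V"
    and pos: "\<And>x. x \<in> V \<Longrightarrow> 0 \<le> N x" and zero: "\<And>x. x \<in> V \<Longrightarrow> N x = 0 \<longleftrightarrow> x = 0"
    and scale: "\<And>x c. x \<in> V \<Longrightarrow> N (c *\<^sub>R x) = \<bar>c\<bar> * N x"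
    and tri: "\<And>x y. x \<in> V \<Longrightarrow> y \<in> V \<Longrightarrow> N (x + y) \<le> N x + N y"
    using assms by (auto simp: normed_space_on_def)
  have diff: "x - y \<in> V" if "x \<in> V" "y \<in> V" for x y
    using that sub by (rule_tac subspace_diff)
  fix x y z
  show "0 \<le> norm_dist V N x y"
    by (auto simp: norm_dist_def intro: pos diff)
  show "norm_dist V N x y = norm_dist V N y x"
  proof (cases "x \<in> V \<and> y \<in> V")
    case True
    then show ?thesis
      using scale[of "x - y" "-1"] diff by (auto simp: norm_dist_def)
  qed (auto simp: norm_dist_def)
  show "norm_dist V N x y = 0 \<longleftrightarrow> x = y" if "x \<in> V" "y \<in> V"
    using that zero[of "x - y"] diff by (auto simp: norm_dist_def)
  show "norm_dist V N x z \<le> norm_dist V N x y + norm_dist V N y z"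
    if "x \<in> V" "y \<in> V" "z \<in> V"
    using that tri[of "x - y" "y - z"] diff by (auto simp: norm_dist_def)
qed

definition banach_space_on :: "'u::real_vector set \<Rightarrow> ('u \<Rightarrow> real) \<Rightarrow> bool" where
  "banach_space_on V N \<longleftrightarrow> normed_space_on V N \<and> Metric_space.mcomplete V (norm_dist V N)"

definition norm_topology :: "'u::real_vector set \<Rightarrow> ('u \<Rightarrow> real) \<Rightarrow> 'u topology" where
  "norm_topology V N = Metric_space.mtopology V (norm_dist V N)"

definition finite_dim :: "'u::real_vector set \<Rightarrow> bool" where
  "finite_dim V \<longleftrightarrow> (\<exists>B. finite B \<and> V \<subseteq> span B)"

definition fin_dim_subspaces :: "'u::real_vector set \<Rightarrow> 'u set set" where
  "fin_dim_subspaces V = {F. subspace F \<and> F \<subseteq> V \<and> finite_dim F}"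

definition Sub :: "'u::real_vector set \<Rightarrow> ('u \<Rightarrow> real) \<Rightarrow> 'u set set" where
  "Sub V N = {Y. subspace Y \<and> closedin (norm_topology V N) Y}"


section \<open>Bounded operators between such spaces\<close>

definition bounded_operator ::
  "'u::real_vector set \<Rightarrow> ('u \<Rightarrow> real) \<Rightarrow> 'u set \<Rightarrow> ('u \<Rightarrow> real) \<Rightarrow> ('u \<Rightarrow> 'u) \<Rightarrow> bool" where
  "bounded_operator V N W M T \<longleftrightarrow>
     T \<in> V \<rightarrow> W \<and>
     (\<forall>x\<in>V. \<forall>y\<in>V. T (x + y) = T x + T y) \<and>
     (\<forall>x\<in>V. \<forall>c. T (c *\<^sub>R x) = c *\<^sub>R T x) \<and>
     (\<exists>C. \<forall>x\<in>V. M (T x) \<le> C * N x)"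

text \<open>As in the library's \<^const>\<open>onorm\<close>, the quotient is \<open>0\<close> at \<open>x = 0\<close>.\<close>

definition op_norm ::
  "'u::real_vector set \<Rightarrow> ('u \<Rightarrow> real) \<Rightarrow> ('u \<Rightarrow> real) \<Rightarrow> ('u \<Rightarrow> 'u) \<Rightarrow> real" where
  "op_norm V N M T = (SUP x\<in>V. M (T x) / N x)"

definition isomorphism ::
  "'u::real_vector set \<Rightarrow> ('u \<Rightarrow> real) \<Rightarrow> 'u set \<Rightarrow> ('u \<Rightarrow> real) \<Rightarrow> ('u \<Rightarrow> 'u) \<Rightarrow> bool" where
  "isomorphism V N W M T \<longleftrightarrow>
     bij_betw T V W \<and> bounded_operator V N W M T \<and> bounded_operator W M V N (inv_into V T)"


section \<open>Degrees\<close>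

definition approx_pair :: "'u::real_vector set \<Rightarrow> ('u \<Rightarrow> real) \<Rightarrow> 'u set \<Rightarrow> bool" where
  "approx_pair V N F \<longleftrightarrow> banach_space_on V N \<and> F \<in> fin_dim_subspaces V"

text \<open>\<open>(S, T)\<close> is a morphism from the pair \<open>((V, N), F)\<close> to the pair \<open>((W, M), G)\<close>.\<close>

definition morphism ::
  "'u::real_vector set \<Rightarrow> ('u \<Rightarrow> real) \<Rightarrow> 'u set \<Rightarrow> 'u set \<Rightarrow> ('u \<Rightarrow> real) \<Rightarrow> 'u set
     \<Rightarrow> ('u \<Rightarrow> 'u) \<Rightarrow> ('u \<Rightarrow> 'u) \<Rightarrow> bool" where
  "morphism V N F W M G S T \<longleftrightarrow>
     approx_pair V N F \<and> approx_pair W M G \<and>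
     bounded_operator G M F N S \<and> bounded_operator V N W M T \<and>
     (\<forall>g\<in>G. T (S g) = g)"

definition morphism_norm ::
  "'u::real_vector set \<Rightarrow> ('u \<Rightarrow> real) \<Rightarrow> ('u \<Rightarrow> real) \<Rightarrow> 'u set
     \<Rightarrow> ('u \<Rightarrow> 'u) \<Rightarrow> ('u \<Rightarrow> 'u) \<Rightarrow> real" where
  "morphism_norm V N M G S T = (if G = {0} then 1 else op_norm G M N S * op_norm V N M T)"

text \<open>\<open>K\<close> is a function on \<open>[1, \<infinity>) \<times> [0, \<infinity>)\<close>; its other values are not constrained.\<close>

definition is_degree :: "('u::real_vector set \<Rightarrow> ('u \<Rightarrow> real) \<Rightarrow> 'u set \<Rightarrow> real) \<Rightarrow> bool" where
  "is_degree d \<longleftrightarrow>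
     (\<forall>V N F. approx_pair V N F \<longrightarrow> 0 \<le> d V N F) \<and>
     (\<exists>K :: real \<Rightarrow> real \<Rightarrow> real.
        (\<forall>s\<ge>1. \<forall>t\<ge>0. 0 \<le> K s t) \<and>
        (\<forall>s\<ge>1. \<forall>s'\<ge>s. \<forall>t\<ge>0. \<forall>t'\<ge>t. K s t \<le> K s' t') \<and>
        (\<forall>t\<ge>0. ((\<lambda>s. K s t) \<longlongrightarrow> t) (at 1 within {1..})) \<and>
        (\<forall>V N F W M G S T. morphism V N F W M G S T \<longrightarrow>
           d W M G \<le> K (morphism_norm V N M G S T) (d V N F)))"

definition d_small ::
  "('u::real_vector set \<Rightarrow> ('u \<Rightarrow> real) \<Rightarrow> 'u set \<Rightarrow> real) \<Rightarrow> 'u set \<Rightarrow> ('u \<Rightarrow> real) \<Rightarrow> bool" where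
  "d_small d V N \<longleftrightarrow> bdd_above (d V N ` fin_dim_subspaces V)"

abbreviation d_large ::
  "('u::real_vector set \<Rightarrow> ('u \<Rightarrow> real) \<Rightarrow> 'u set \<Rightarrow> real) \<Rightarrow> 'u set \<Rightarrow> ('u \<Rightarrow> real) \<Rightarrow> bool" where
  "d_large d V N \<equiv> \<not> d_small d V N"


section \<open>The Ellentuck topology and D-families\<close>

definition ellentuck_nbhd ::
  "'u::real_vector set \<Rightarrow> ('u \<Rightarrow> real) \<Rightarrow> 'u set \<Rightarrow> 'u set \<Rightarrow> real \<Rightarrow> 'u set set" where
  "ellentuck_nbhd V N F Y \<epsilon> =
     {Z \<in> Sub V N. \<exists>Z'\<in>Sub V N. F \<subseteq> Z' \<and> Z' \<subseteq> Y \<and>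
        (\<exists>T. isomorphism Z' N Z N T \<and> op_norm Z' N N (\<lambda>x. T x - x) < \<epsilon>)}"

text \<open>The sets \<^const>\<open>ellentuck_nbhd\<close> form a basis, so the topology generated by them as a subbasis
  is the one whose open sets are their unions.\<close>

definition ellentuck_topology ::
  "'u::real_vector set \<Rightarrow> ('u \<Rightarrow> real) \<Rightarrow> 'u set topology" where
  "ellentuck_topology V N = topology_generated_by
     {ellentuck_nbhd V N F Y \<epsilon> | F Y \<epsilon>. Y \<in> Sub V N \<and> F \<in> fin_dim_subspaces Y \<and> \<epsilon> > 0}"

definition D_family ::
  "'u::real_vector set \<Rightarrow> ('u \<Rightarrow> real) \<Rightarrow> 'u set set \<Rightarrow> bool" where
  "D_family V N H \<longleftrightarrow>
     H \<subseteq> {Y \<in> Sub V N. \<not> finite_dim Y} \<and>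
     gdelta_in (ellentuck_topology V N) H \<and>
     (\<forall>Y\<in>Sub V N. \<not> finite_dim Y \<longrightarrow>
        (\<forall>F\<in>fin_dim_subspaces V. Y \<in> H \<longleftrightarrow> Y + F \<in> H))"

end

theory Submission
  imports Defs
begin

text \<open>
  A degree is compared between two pairs by exhibiting a morphism, and only the norm of the morphism
  enters the estimate. Since \<open>K 1 t \<le> t\<close>, inclusions do not increase the degree: \<open>d Y G \<le> d Z F\<close>
  for \<open>G \<subseteq> F \<subseteq> Z \<subseteq> Y\<close> (\<open>degree_antimono_space\<close>). In particular a finite-dimensional space is small,
  with bound \<open>d Y Y\<close>.

  The large subspaces form a \<open>G\<^sub>\<delta>\<close> set because they are the intersection over \<open>n\<close> of the sets of those
  \<open>Y\<close> that contain some \<open>F\<close> with \<open>d Y F > n\<close>, and these are open. Such an \<open>F\<close> keeps its property in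
  every subspace \<open>Z'\<close> with \<open>F \<subseteq> Z' \<subseteq> Y\<close>, and an isomorphism \<open>T\<close> of \<open>Z'\<close> onto \<open>Z\<close> near the identity yields
  a morphism of norm close to \<open>1\<close> from \<open>(Z, T F)\<close> to \<open>(Z', F)\<close>. If \<open>d Z (T F)\<close> were at most \<open>n\<close>, then
  \<open>d Y F\<close> would be at most \<open>K s n\<close> for an \<open>s\<close> near \<open>1\<close>, which is less than \<open>d Y F\<close>
  (\<open>ellentuck_nbhd_degree\<close>).

  For the invariance under finite-dimensional sums it suffices to add one line, spanned by some \<open>f\<close>
  outside the infinite-dimensional \<open>Y\<close> (\<open>small_iff_small_add_line\<close>). The bounded projection of
  \<open>Y + span {f}\<close> onto \<open>Y\<close> shows that \<open>Y\<close> is small if the sum is. For the converse, \<open>Y\<close> need not be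
  isomorphic to the sum, so the morphism has to depend on the finite-dimensional subspace \<open>G\<close> of the
  sum: a vector \<open>e\<close> of \<open>Y\<close> far from the projection of \<open>G\<close> to \<open>Y\<close> takes over the role of \<open>f\<close>, and a
  functional \<open>\<phi>\<close> with \<open>\<phi> e = 1\<close> that vanishes on this projection is used to turn \<open>e\<close> back into \<open>f\<close>.
  What matters is that \<open>e\<close> and \<open>\<phi>\<close> can be chosen with norms bounded independently of \<open>G\<close>; this is the
  Riesz lemma combined with the Hahn-Banach theorem (\<open>riesz_functional\<close>).
\<close>


section \<open>Linear functionals dominated by a sublinear functional\<close>

text \<open>Positive homogeneity is required as an inequality only: applied to \<open>1 / c\<close> it gives the
  equation, and the inequality is what passes to infima.\<close>

definition sublinear :: "('a::real_vector \<Rightarrow> real) \<Rightarrow> bool" where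
  "sublinear p \<longleftrightarrow>
     (\<forall>x y. p (x + y) \<le> p x + p y) \<and> (\<forall>c\<ge>0. \<forall>x. p (c *\<^sub>R x) \<le> c * p x)"

lemma sublinear_add: "sublinear p \<Longrightarrow> p (x + y) \<le> p x + p y"
  by (simp add: sublinear_def)

lemma sublinear_zero: "sublinear p \<Longrightarrow> p 0 = 0"
  using sublinear_add[of p 0 0] by (auto simp: sublinear_def dest: spec[of _ 0])

lemma sublinear_scaleR:
  assumes "sublinear p" "0 \<le> c"
  shows "p (c *\<^sub>R x) = c * p x"
proof (cases "c = 0")
  case False
  then have c: "c > 0" using assms by simp
  have "p (c *\<^sub>R x) \<le> c * p x" using assms by (simp add: sublinear_def)
  moreover have "p ((1/c) *\<^sub>R (c *\<^sub>R x)) \<le> (1/c) * p (c *\<^sub>R x)"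
    using assms c unfolding sublinear_def by (meson divide_nonneg_nonneg zero_le_one)
  ultimately show ?thesis using c by (simp add: field_simps)
qed (use sublinear_zero assms in auto)

lemma sublinear_uminus: "sublinear p \<Longrightarrow> - p (- x) \<le> p x"
  using sublinear_add[of p x "- x"] sublinear_zero[of p] by simp

text \<open>The common pattern behind the three infima used below: a bound that holds for some member of
  the family on the left, for any choice of members on the right, passes to the infimum.\<close>

lemma sublinear_INF:
  fixes f :: "'i \<Rightarrow> 'a::real_vector \<Rightarrow> real"
  assumes ne: "I \<noteq> {}"
    and bdd: "\<And>x. bdd_below ((\<lambda>i. f i x) ` I)"
    and add: "\<And>i j x y. i \<in> I \<Longrightarrow> j \<in> I \<Longrightarrow> \<exists>k\<in>I. f k (x + y) \<le> f i x + f j y"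
    and scale: "\<And>i c x. 0 \<le> c \<Longrightarrow> i \<in> I \<Longrightarrow> \<exists>k\<in>I. f k (c *\<^sub>R x) \<le> c * f i x"
  shows "sublinear (\<lambda>x. INF i\<in>I. f i x)"
  unfolding sublinear_def
proof (intro conjI allI impI)
  fix x y
  have sum: "(INF k\<in>I. f k (x + y)) \<le> f i x + f j y" if ij: "i \<in> I" "j \<in> I" for i j
  proof -
    obtain k where k: "k \<in> I" "f k (x + y) \<le> f i x + f j y" using add[OF ij] by blast
    then show ?thesis using cINF_lower[OF bdd k(1)] by (rule_tac order_trans)
  qed
  have "(INF k\<in>I. f k (x + y)) - (INF j\<in>I. f j y) \<le> f i x" if "i \<in> I" for i
  proof -
    have "(INF k\<in>I. f k (x + y)) - f i x \<le> (INF j\<in>I. f j y)"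
      by (rule cINF_greatest[OF ne]) (use sum[OF that] in force)
    then show ?thesis by simp
  qed
  then have "(INF k\<in>I. f k (x + y)) - (INF j\<in>I. f j y) \<le> (INF i\<in>I. f i x)"
    by (rule cINF_greatest[OF ne])
  then show "(INF k\<in>I. f k (x + y)) \<le> (INF i\<in>I. f i x) + (INF i\<in>I. f i y)" by simp
next
  fix c :: real and x assume c: "0 \<le> c"
  have le: "(INF k\<in>I. f k (c *\<^sub>R x)) \<le> c * f i x" if i: "i \<in> I" for i
  proof -
    obtain k where k: "k \<in> I" "f k (c *\<^sub>R x) \<le> c * f i x" using scale[OF c i] by blast
    then show ?thesis using cINF_lower[OF bdd k(1)] by (rule_tac order_trans)
  qed
  show "(INF k\<in>I. f k (c *\<^sub>R x)) \<le> c * (INF i\<in>I. f i x)"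
  proof (cases "c = 0")
    case True
    then show ?thesis using le ne by auto
  next
    case False
    then have "(INF k\<in>I. f k (c *\<^sub>R x)) / c \<le> (INF i\<in>I. f i x)"
      by (intro cINF_greatest[OF ne]) (use c le in \<open>auto simp: field_simps\<close>)
    then show ?thesis using c False by (simp add: field_simps)
  qed
qed

text \<open>Moving far in the direction \<open>e\<close> before evaluating makes a sublinear functional linear along
  the line through \<open>e\<close>, with the same value at \<open>e\<close>: the value at \<open>- e\<close> drops to \<open>- p e\<close>.\<close>

lemma sublinear_straighten:
  assumes p: "sublinear p"
  obtains q where "sublinear q" "q \<le> p" "q (- e) \<le> - p e"
proof
  define f where "f = (\<lambda>t x. p (x + t *\<^sub>R e) - t * p e)"
  have lower: "- p (- x) \<le> f t x" if "t \<ge> 0" for t x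
    using sublinear_add[OF p, of "x + t *\<^sub>R e" "- x"] sublinear_scaleR[OF p that]
    by (simp add: f_def)
  have bdd: "bdd_below ((\<lambda>t. f t x) ` {0..})" for x
    by (rule bdd_belowI[of _ "- p (- x)"]) (use lower in auto)
  show "sublinear (\<lambda>x. INF t\<in>{0..}. f t x)"
  proof (rule sublinear_INF[OF _ bdd])
    fix s t :: real and x y assume "s \<in> {0..}" "t \<in> {0..}"
    have "x + y + (s + t) *\<^sub>R e = (x + s *\<^sub>R e) + (y + t *\<^sub>R e)"
      by (simp add: algebra_simps)
    then have "f (s + t) (x + y) \<le> f s x + f t y"
      using sublinear_add[OF p, of "x + s *\<^sub>R e" "y + t *\<^sub>R e"]
      by (simp add: f_def algebra_simps)
    then show "\<exists>k\<in>{0..}. f k (x + y) \<le> f s x + f t y"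
      using \<open>s \<in> _\<close> \<open>t \<in> _\<close> by (intro bexI[of _ "s + t"]) auto
  next
    fix t c :: real and x assume "t \<in> {0..}" "0 \<le> c"
    have "f (c * t) (c *\<^sub>R x) = c * f t x"
      using sublinear_scaleR[OF p \<open>0 \<le> c\<close>, of "x + t *\<^sub>R e"]
      by (simp add: f_def algebra_simps)
    then show "\<exists>k\<in>{0..}. f k (c *\<^sub>R x) \<le> c * f t x"
      using \<open>t \<in> _\<close> \<open>0 \<le> c\<close> by (intro bexI[of _ "c * t"]) auto
  qed auto
  show "(\<lambda>x. INF t\<in>{0..}. f t x) \<le> p"
    using cINF_lower[OF bdd, of 0] by (auto simp: le_fun_def f_def)
  show "(INF t\<in>{0..}. f t (- e)) \<le> - p e"
    using cINF_lower[OF bdd, of 1 "- e"] sublinear_zero[OF p] by (simp add: f_def)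
qed

text \<open>Zorn's lemma applies because \<open>- p (- x)\<close> bounds the values at \<open>x\<close> of all sublinear functionals
  below \<open>p\<close> from below, so that the pointwise infimum of a chain exists.\<close>

lemma minimal_sublinear:
  assumes p: "sublinear p"
  obtains m where "sublinear m" "m \<le> p" "\<And>q. sublinear q \<Longrightarrow> q \<le> m \<Longrightarrow> q = m"
proof -
  define A where "A = {q. sublinear q \<and> q \<le> p}"
  have "\<exists>m\<in>A. \<forall>q\<in>A. m \<ge> q \<longrightarrow> q = m"
  proof (rule predicate_Zorn)
    show "partial_order_on A (relation_of (\<ge>) A)"
      by (rule partial_order_on_relation_ofI) auto
  next
    fix C assume C: "C \<in> Chains (relation_of (\<ge>) A)"
    have CA: "C \<subseteq> A" and chain: "\<And>q r. q \<in> C \<Longrightarrow> r \<in> C \<Longrightarrow> q \<le> r \<or> r \<le> q"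
      using C by (auto simp: Chains_def relation_of_def)
    show "\<exists>u\<in>A. \<forall>q\<in>C. q \<ge> u"
    proof (cases "C = {}")
      case True
      then show ?thesis using p by (auto simp: A_def)
    next
      case False
      have lower: "- p (- x) \<le> q x" if "q \<in> C" for q x
      proof -
        have "q (- x) \<le> p (- x)" "- q (- x) \<le> q x"
          using CA that sublinear_uminus by (auto simp: A_def le_fun_def)
        then show ?thesis by linarith
      qed
      have bdd: "bdd_below ((\<lambda>q. q x) ` C)" for x
        by (rule bdd_belowI[of _ "- p (- x)"]) (use lower in auto)
      have "sublinear (\<lambda>x. INF q\<in>C. q x)"
      proof (rule sublinear_INF[OF False bdd])
        fix q r x y assume qr: "q \<in> C" "r \<in> C"
        then have s: "q (x + y) \<le> q x + q y" "r (x + y) \<le> r x + r y"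
          using CA by (auto simp: A_def sublinear_def)
        show "\<exists>k\<in>C. k (x + y) \<le> q x + r y"
          using chain[OF qr]
        proof
          assume "q \<le> r"
          then show ?thesis using s qr le_funD[of q r y] by (intro bexI[of _ q]) auto
        next
          assume "r \<le> q"
          then show ?thesis using s qr le_funD[of r q x] by (intro bexI[of _ r]) auto
        qed
      qed (use CA in \<open>auto simp: A_def sublinear_def\<close>)
      moreover have low: "(\<lambda>x. INF q\<in>C. q x) \<le> q" if "q \<in> C" for q
        using cINF_lower[OF bdd that] by (auto simp: le_fun_def)
      moreover have "(\<lambda>x. INF q\<in>C. q x) \<le> p"
        using False CA low by (force simp: A_def)
      ultimately show ?thesis
        by (intro bexI[of _ "\<lambda>x. INF q\<in>C. q x"]) (auto simp: A_def)
    qed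
  qed
  then obtain m where m: "m \<in> A" and min: "\<And>q. q \<in> A \<Longrightarrow> q \<le> m \<Longrightarrow> q = m" by blast
  show ?thesis
  proof
    show "sublinear m" "m \<le> p" using m by (auto simp: A_def)
    show "q = m" if "sublinear q" "q \<le> m" for q
      by (rule min) (use that \<open>m \<le> p\<close> in \<open>auto simp: A_def\<close>)
  qed
qed

text \<open>A minimal sublinear functional cannot be straightened any further, so it is odd, and an odd
  sublinear functional is linear. Straightening \<open>p\<close> along \<open>e\<close> before minimizing keeps the value
  at \<open>e\<close>.\<close>

theorem hahn_banach_dominated:
  fixes p :: "'a::real_vector \<Rightarrow> real"
  assumes p: "sublinear p"
  obtains \<phi> where "linear \<phi>" "\<And>x. \<phi> x \<le> p x" "\<phi> e = p e"
proof -
  obtain p' where p': "sublinear p'" "p' \<le> p" "p' (- e) \<le> - p e"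
    using sublinear_straighten[OF p] by blast
  obtain m where m: "sublinear m" "m \<le> p'" and min: "\<And>q. sublinear q \<Longrightarrow> q \<le> m \<Longrightarrow> q = m"
    using minimal_sublinear[OF p'(1)] by blast
  have odd: "m (- x) = - m x" for x
  proof -
    obtain q where q: "sublinear q" "q \<le> m" "q (- x) \<le> - m x"
      using sublinear_straighten[OF m(1)] by blast
    then show ?thesis using min[OF q(1,2)] sublinear_uminus[OF m(1), of x] by simp
  qed
  have "linear m"
  proof (rule linearI)
    fix x y
    show "m (x + y) = m x + m y"
      using sublinear_add[OF m(1), of x y] sublinear_add[OF m(1), of "- x" "- y"] odd[of "x + y"]
        odd[of x] odd[of y] by simp
  next
    fix c x
    show "m (c *\<^sub>R x) = c *\<^sub>R m x"
    proof (cases "c \<ge> 0")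
      case False
      then have "m ((- c) *\<^sub>R x) = (- c) * m x" by (intro sublinear_scaleR[OF m(1)]) simp
      then show ?thesis using odd[of "c *\<^sub>R x"] by simp
    qed (simp add: sublinear_scaleR[OF m(1)])
  qed
  moreover have le: "m x \<le> p x" for x
    using m(2) p'(2) by (meson le_funD order_trans)
  moreover have "m e = p e"
    using le[of e] odd[of e] le_funD[OF m(2), of "- e"] p'(3) by linarith
  ultimately show ?thesis using that by blast
qed


section \<open>Closed subspaces and functionals of a normed space\<close>

lemma finite_dim_mono: "V \<subseteq> W \<Longrightarrow> finite_dim W \<Longrightarrow> finite_dim V"
  unfolding finite_dim_def by blast

text \<open>The spanning set in \<^const>\<open>finite_dim\<close> may lie outside the subspace; a basis does not.\<close>

lemma finite_dim_subspace_basis: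
  assumes "subspace F" "finite_dim F"
  obtains B where "finite B" "B \<subseteq> F" "span B = F"
proof -
  obtain C where C: "finite C" "F \<subseteq> span C" using assms by (auto simp: finite_dim_def)
  obtain B where B: "B \<subseteq> F" "independent B" "F \<subseteq> span B"
    using maximal_independent_subset by blast
  have "finite B" using independent_span_bound[of C B] B C by auto
  then show ?thesis using that[of B] B assms(1) span_minimal[of B F] by blast
qed

locale normed_subspace =
  fixes X :: "'u::real_vector set" and N :: "'u \<Rightarrow> real"
  assumes normed: "normed_space_on X N"
begin

lemma subspace_carrier: "subspace X"
  and norm_nonneg: "x \<in> X \<Longrightarrow> 0 \<le> N x"
  and norm_eq_0: "x \<in> X \<Longrightarrow> N x = 0 \<longleftrightarrow> x = 0"
  and norm_scale: "x \<in> X \<Longrightarrow> N (c *\<^sub>R x) = \<bar>c\<bar> * N x"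
  and norm_add: "x \<in> X \<Longrightarrow> y \<in> X \<Longrightarrow> N (x + y) \<le> N x + N y"
  using normed by (auto simp: normed_space_on_def)

lemma carrier_closed:
  "x \<in> X \<Longrightarrow> y \<in> X \<Longrightarrow> x + y \<in> X" "x \<in> X \<Longrightarrow> y \<in> X \<Longrightarrow> x - y \<in> X"
  "x \<in> X \<Longrightarrow> c *\<^sub>R x \<in> X" "0 \<in> X"
  using subspace_carrier by (auto intro: subspace_add subspace_diff subspace_mul subspace_0)

lemma norm_diff: "x \<in> X \<Longrightarrow> y \<in> X \<Longrightarrow> N (x - y) \<le> N x + N y"
  using norm_add[of x "(- 1) *\<^sub>R y"] norm_scale[of y "- 1"] carrier_closed(3)[of y "- 1"] by simp

lemma normed_subset:
  assumes "subspace Y" "Y \<subseteq> X"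
  shows "normed_space_on Y N"
  unfolding normed_space_on_def
  using assms subsetD[OF assms(2)] norm_nonneg norm_eq_0 norm_scale norm_add by simp

lemma Sub_iff:
  "Y \<in> Sub X N \<longleftrightarrow> subspace Y \<and> Y \<subseteq> X \<and> (\<forall>x\<in>X - Y. \<exists>\<delta>>0. \<forall>y\<in>Y. \<delta> \<le> N (x - y))"
proof -
  interpret Metric_space X "norm_dist X N" by (rule Metric_space_norm_dist[OF normed])
  have "disjnt Y (mball x r) \<longleftrightarrow> (\<forall>y\<in>Y. r \<le> N (x - y))" if "x \<in> X" "Y \<subseteq> X" for x r
    using that by (auto simp: disjnt_iff norm_dist_def subset_iff not_less)
  then show ?thesis
    by (auto simp: Sub_def norm_topology_def closedin_metric)
qed

lemma SubD:
  assumes "Y \<in> Sub X N"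
  shows "subspace Y" "Y \<subseteq> X"
  using assms by (auto simp: Sub_iff)

text \<open>The dominating sublinear functional is the distance to \<open>Y\<close>. The norm is only meaningful
  on \<open>X\<close>, so it is first composed with an algebraic projection of the whole vector space onto
  \<open>X\<close>; then the resulting functional is linear everywhere.\<close>

lemma functional_vanishing_on:
  assumes Y: "subspace Y" "Y \<subseteq> X" and f: "f \<in> X" and \<delta>: "\<delta> > 0"
    and dist: "\<And>y. y \<in> Y \<Longrightarrow> \<delta> \<le> N (f - y)"
  obtains \<phi> where "linear \<phi>" "\<And>y. y \<in> Y \<Longrightarrow> \<phi> y = 0" "\<phi> f = 1"
    "\<And>x. x \<in> X \<Longrightarrow> \<bar>\<phi> x\<bar> \<le> N x / \<delta>"
proof -
  obtain \<pi> :: "'u \<Rightarrow> 'u" where \<pi>: "range \<pi> \<subseteq> X" "linear \<pi>" "\<And>x. x \<in> X \<Longrightarrow> \<pi> x = x"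
    using linear_exists_left_inverse_on[of "\<lambda>x. x" X] subspace_carrier linear_ident by auto
  interpret \<pi>: linear \<pi> by fact
  have \<pi>X: "\<pi> x \<in> X" for x using \<pi>(1) by auto
  have Y0: "0 \<in> Y" and Yadd: "\<And>x y. x \<in> Y \<Longrightarrow> y \<in> Y \<Longrightarrow> x + y \<in> Y"
    and Yscale: "\<And>c y. y \<in> Y \<Longrightarrow> c *\<^sub>R y \<in> Y"
    using Y by (auto intro: subspace_0 subspace_add subspace_mul)
  define q where "q = (\<lambda>x. INF y\<in>Y. N (\<pi> x - y))"
  have inX: "\<pi> x - y \<in> X" if "y \<in> Y" for x y using carrier_closed(2)[OF \<pi>X] Y that by blast
  have bdd: "bdd_below ((\<lambda>y. N (\<pi> x - y)) ` Y)" for x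
    by (rule bdd_belowI[of _ 0]) (use norm_nonneg inX in auto)
  have q: "sublinear q"
    unfolding q_def
  proof (rule sublinear_INF[OF _ bdd])
    fix y z x w assume yz: "y \<in> Y" "z \<in> Y"
    have "\<pi> (x + w) - (y + z) = (\<pi> x - y) + (\<pi> w - z)" by (simp add: \<pi>.add)
    then have "N (\<pi> (x + w) - (y + z)) \<le> N (\<pi> x - y) + N (\<pi> w - z)"
      using norm_add[OF inX[OF yz(1)] inX[OF yz(2)]] by metis
    then show "\<exists>k\<in>Y. N (\<pi> (x + w) - k) \<le> N (\<pi> x - y) + N (\<pi> w - z)"
      using Yadd[OF yz] by blast
  next
    fix y c x assume y: "y \<in> Y" and c: "(0::real) \<le> c"
    have "\<pi> (c *\<^sub>R x) - c *\<^sub>R y = c *\<^sub>R (\<pi> x - y)"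
      by (simp add: \<pi>.scale scaleR_diff_right)
    then have "N (\<pi> (c *\<^sub>R x) - c *\<^sub>R y) \<le> c * N (\<pi> x - y)"
      using norm_scale[OF inX[OF y]] c by simp
    then show "\<exists>k\<in>Y. N (\<pi> (c *\<^sub>R x) - k) \<le> c * N (\<pi> x - y)"
      using Yscale[OF y] by blast
  qed (use Y0 in auto)
  obtain \<psi> where \<psi>: "linear \<psi>" "\<And>x. \<psi> x \<le> q x" "\<psi> f = q f"
    using hahn_banach_dominated[OF q] by blast
  have qf: "\<delta> \<le> q f"
    unfolding q_def by (rule cINF_greatest) (use Y0 dist \<pi>(3) f in auto)
  have qN: "\<psi> x \<le> N x" if "x \<in> X" for x
    using cINF_lower[OF bdd Y0, of x] \<psi>(2)[of x] \<pi>(3)[OF that] by (simp add: q_def)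
  have le0: "\<psi> y \<le> 0" if "y \<in> Y" for y
    using cINF_lower[OF bdd that, of y] \<psi>(2)[of y] \<pi>(3)[of y] that Y norm_eq_0[of 0] carrier_closed(4)
    by (auto simp: q_def subset_iff)
  show ?thesis
  proof
    show "linear (\<lambda>x. \<psi> x / q f)"
      using \<psi>(1) by (auto intro!: linearI simp: linear_add linear_scale add_divide_distrib)
    show "\<psi> y / q f = 0" if "y \<in> Y" for y
      using le0[OF that] le0[OF Yscale[OF that, of "- 1"]] linear_neg[OF \<psi>(1), of y] by simp
    show "\<psi> f / q f = 1" using \<psi>(3) qf \<delta> by simp
    show "\<bar>\<psi> x / q f\<bar> \<le> N x / \<delta>" if x: "x \<in> X" for x
    proof -
      have "\<psi> (- x) \<le> N x"
        using qN[of "- x"] carrier_closed(3)[OF x, of "- 1"] norm_scale[OF x, of "- 1"] by simp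
      then have "\<bar>\<psi> x\<bar> \<le> N x" using qN[OF x] linear_neg[OF \<psi>(1), of x] by simp
      then show ?thesis using qf \<delta> norm_nonneg[OF x] by (auto simp: abs_divide intro: frac_le)
    qed
  qed
qed

lemma coordinate_functional:
  assumes Y: "Y \<in> Sub X N" and f: "f \<in> X" "f \<notin> Y"
  obtains \<phi> C where "linear \<phi>" "\<And>y. y \<in> Y \<Longrightarrow> \<phi> y = 0" "\<phi> f = 1"
    "0 \<le> C" "\<And>x. x \<in> X \<Longrightarrow> \<bar>\<phi> x\<bar> \<le> C * N x"
proof -
  obtain \<delta> where \<delta>: "\<delta> > 0" "\<And>y. y \<in> Y \<Longrightarrow> \<delta> \<le> N (f - y)"
    using Y f unfolding Sub_iff by blast
  obtain \<phi> where "linear \<phi>" "\<And>y. y \<in> Y \<Longrightarrow> \<phi> y = 0" "\<phi> f = 1"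
    "\<And>x. x \<in> X \<Longrightarrow> \<bar>\<phi> x\<bar> \<le> N x / \<delta>"
    using functional_vanishing_on[OF SubD[OF Y] f(1) \<delta>] by blast
  then show ?thesis using that[of \<phi> "1 / \<delta>"] \<delta> by simp
qed

lemma norm_coordinate_projection_le:
  assumes f: "f \<in> X" and x: "x \<in> X" and t: "\<bar>t\<bar> \<le> C * N x"
  shows "N (x - t *\<^sub>R f) \<le> (1 + C * N f) * N x"
proof -
  have "N (x - t *\<^sub>R f) \<le> N x + \<bar>t\<bar> * N f"
    using norm_diff[OF x carrier_closed(3)[OF f]] norm_scale[OF f] by metis
  also have "\<dots> \<le> N x + (C * N x) * N f"
    using t norm_nonneg[OF f] by (intro add_left_mono mult_right_mono)
  finally show ?thesis by (simp add: algebra_simps)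
qed

lemma mem_add_line: "w \<in> Y + span {f} \<longleftrightarrow> (\<exists>y\<in>Y. \<exists>t. w = y + t *\<^sub>R f)"
  by (auto simp: set_plus_def span_singleton)

text \<open>With \<open>\<phi>\<close> the coordinate along \<open>f\<close>, the projection \<open>x - \<phi> x f\<close> is bounded and a point outside
  the sum is projected outside \<open>Y\<close>, at a positive distance from it.\<close>

lemma Sub_add_line:
  assumes Y: "Y \<in> Sub X N" and f: "f \<in> X" "f \<notin> Y"
  shows "Y + span {f} \<in> Sub X N"
  unfolding Sub_iff
proof (intro conjI ballI)
  note YD = SubD[OF Y]
  show "subspace (Y + span {f})"
    using subspace_sums[OF YD(1) subspace_span[of "{f}"]] by (simp add: set_plus_def Bex_def conj_ac)
  show sub: "Y + span {f} \<subseteq> X"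
    using YD(2) f(1) carrier_closed(1,3) by (force simp: mem_add_line)
  obtain \<phi> C where \<phi>: "linear \<phi>" "\<And>y. y \<in> Y \<Longrightarrow> \<phi> y = 0" "\<phi> f = 1"
    "0 \<le> C" "\<And>x. x \<in> X \<Longrightarrow> \<bar>\<phi> x\<bar> \<le> C * N x"
    using coordinate_functional[OF Y f] by blast
  define P where "P = (\<lambda>x. x - \<phi> x *\<^sub>R f)"
  define D where "D = 1 + C * N f"
  have D: "D > 0" using \<phi>(4) norm_nonneg[OF f(1)] by (auto simp: D_def intro: add_pos_nonneg)
  have PX: "P x \<in> X" if "x \<in> X" for x using that f carrier_closed by (simp add: P_def)
  have PN: "N (P x) \<le> D * N x" if "x \<in> X" for x
    unfolding P_def D_def by (rule norm_coordinate_projection_le[OF f(1) that \<phi>(5)[OF that]])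
  fix x assume x: "x \<in> X - (Y + span {f})"
  have "P x \<notin> Y"
  proof
    assume "P x \<in> Y"
    moreover have "x = P x + \<phi> x *\<^sub>R f" by (simp add: P_def)
    ultimately have "x \<in> Y + span {f}" unfolding mem_add_line by blast
    then show False using x by blast
  qed
  \<comment> \<open>A gap at \<open>P x\<close> pulls back along \<open>P\<close> to a gap at \<open>x\<close>, smaller by the factor \<open>D\<close>.\<close>
  then obtain \<delta> where \<delta>: "\<delta> > 0" "\<And>y. y \<in> Y \<Longrightarrow> \<delta> \<le> N (P x - y)"
    using Y PX x unfolding Sub_iff by blast
  have "\<delta> / D \<le> N (x - w)" if w: "w \<in> Y + span {f}" for w
  proof -
    obtain y t where y: "y \<in> Y" "w = y + t *\<^sub>R f" using w by (auto simp: mem_add_line)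
    have "P w = y" using y \<phi> by (simp add: P_def linear_add linear_scale)
    moreover have "P (x - w) = P x - P w"
      using \<phi>(1) by (simp add: P_def linear_diff algebra_simps)
    ultimately have "\<delta> \<le> D * N (x - w)"
      using \<delta>(2)[OF y(1)] PN[of "x - w"] x w sub carrier_closed(2)[of x w] by auto
    then show ?thesis using D by (simp add: field_simps)
  qed
  then show "\<exists>\<epsilon>>0. \<forall>w\<in>Y + span {f}. \<epsilon> \<le> N (x - w)"
    using \<delta>(1) D by (intro exI[of _ "\<delta> / D"]) auto
qed

text \<open>Adding a finite-dimensional subspace amounts to adding lines one at a time, each spanned by a
  vector outside the subspace reached so far.\<close>

lemma add_finite_dim_induct [consumes 2, case_names subspace base line]:
  assumes F: "F \<in> fin_dim_subspaces X" and Y: "subspace Y"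
    and subspace: "\<And>W. Q W \<Longrightarrow> subspace W"
    and base: "Q Y"
    and line: "\<And>W f. Q W \<Longrightarrow> f \<in> X \<Longrightarrow> f \<notin> W \<Longrightarrow> Q (W + span {f})"
  shows "Q (Y + F)"
proof -
  obtain B where B: "finite B" "B \<subseteq> F" "span B = F"
    using F finite_dim_subspace_basis by (auto simp: fin_dim_subspaces_def)
  have "finite B \<Longrightarrow> B \<subseteq> X \<Longrightarrow> Q (Y + span B)" for B
  proof (induction rule: finite_induct)
    case empty
    have "Y + span {} = Y" by (auto simp: set_plus_def)
    then show ?case using base by simp
  next
    case (insert f B)
    then have IH: "Q (Y + span B)" by simp
    have "span (insert f B) = span B + span {f}"
      using span_Un[of B "{f}"] by (auto simp: set_plus_def)
    then have eq: "Y + span (insert f B) = (Y + span B) + span {f}" by (simp add: add.assoc)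
    show ?case
    proof (cases "f \<in> Y + span B")
      case True
      have sub: "subspace (Y + span B)" using subspace IH by blast
      have "(Y + span B) + span {f} = Y + span B"
      proof (intro equalityI subsetI)
        fix w assume "w \<in> (Y + span B) + span {f}"
        then show "w \<in> Y + span B"
          using True sub by (auto simp: mem_add_line intro: subspace_add subspace_mul)
      next
        fix w assume "w \<in> Y + span B"
        then show "w \<in> (Y + span B) + span {f}"
          unfolding mem_add_line by (intro bexI[of _ w] exI[of _ 0]) auto
      qed
      then show ?thesis using IH eq by simp
    next
      case False
      then show ?thesis using line[OF IH] insert eq by simp
    qed
  qed
  moreover have "B \<subseteq> X" using B F by (auto simp: fin_dim_subspaces_def)
  ultimately show ?thesis using B by auto
qed

lemma Sub_add_finite_dim:
  assumes "F \<in> fin_dim_subspaces X" "Y \<in> Sub X N"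
  shows "Y + F \<in> Sub X N"
  using assms(1) SubD(1)[OF assms(2)]
proof (induction rule: add_finite_dim_induct)
  case (line W f)
  then show ?case by (rule Sub_add_line)
qed (use assms SubD in auto)

lemma zero_in_Sub: "{0} \<in> Sub X N"
proof -
  have "\<exists>\<delta>>0. \<forall>y\<in>{0}. \<delta> \<le> N (x - y)" if "x \<in> X - {0}" for x
    using that norm_nonneg[of x] norm_eq_0[of x] by (intro exI[of _ "N x"]) auto
  then show ?thesis unfolding Sub_iff using carrier_closed(4) by auto
qed

lemma finite_dim_in_Sub:
  assumes "F \<in> fin_dim_subspaces X"
  shows "F \<in> Sub X N"
proof -
  have "{0} + F = F" by (auto simp: set_plus_def)
  then show ?thesis using Sub_add_finite_dim[OF assms zero_in_Sub] by simp
qed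

text \<open>The Riesz lemma supplies a vector of norm at most \<open>2\<close> at distance at least \<open>1\<close> from \<open>G\<close>: move a
  vector outside \<open>G\<close> by a nearly best approximation from \<open>G\<close> and rescale. The bounds on \<open>e\<close> and
  \<open>\<phi>\<close> are the same for all \<open>G\<close>.\<close>

lemma riesz_functional:
  assumes Y: "Y \<in> Sub X N" "\<not> finite_dim Y" and G: "G \<in> fin_dim_subspaces Y"
  obtains e \<phi> where "e \<in> Y" "N e \<le> 2" "linear \<phi>" "\<And>g. g \<in> G \<Longrightarrow> \<phi> g = 0" "\<phi> e = 1"
    "\<And>x. x \<in> X \<Longrightarrow> \<bar>\<phi> x\<bar> \<le> N x"
proof -
  note YD = SubD[OF Y(1)]
  have G': "subspace G" "G \<subseteq> Y" "G \<in> fin_dim_subspaces X"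
    using G YD by (auto simp: fin_dim_subspaces_def)
  have "\<not> Y \<subseteq> G" using Y(2) G finite_dim_mono by (auto simp: fin_dim_subspaces_def)
  then obtain x where x: "x \<in> Y" "x \<notin> G" by blast
  obtain \<delta>' where \<delta>': "\<delta>' > 0" "\<And>g. g \<in> G \<Longrightarrow> \<delta>' \<le> N (x - g)"
    using finite_dim_in_Sub[OF G'(3)] x YD unfolding Sub_iff by blast
  have G0: "0 \<in> G" using G' subspace_0 by blast
  define \<delta> where "\<delta> = (INF g\<in>G. N (x - g))"
  have bdd: "bdd_below ((\<lambda>g. N (x - g)) ` G)"
    by (rule bdd_belowI[of _ \<delta>']) (use \<delta>' in auto)
  have "\<delta>' \<le> \<delta>" unfolding \<delta>_def by (rule cINF_greatest) (use G0 \<delta>' in auto)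
  then have \<delta>: "\<delta> > 0" using \<delta>' by simp
  then have "\<delta> < 2 * \<delta>" by simp
  then obtain g where g: "g \<in> G" "N (x - g) < 2 * \<delta>"
    using cINF_less_iff[OF _ bdd] G0 unfolding \<delta>_def by blast
  define e where "e = (1 / \<delta>) *\<^sub>R (x - g)"
  have xg: "x - g \<in> Y" using x g G' YD by (auto intro: subspace_diff)
  have eY: "e \<in> Y" using xg YD by (auto simp: e_def intro: subspace_mul)
  have "N e = N (x - g) / \<delta>"
    unfolding e_def using norm_scale[OF subsetD[OF YD(2) xg], of "1 / \<delta>"] \<delta> by simp
  then have Ne: "N e \<le> 2" using g \<delta> by (simp add: pos_divide_le_eq)
  have dist: "1 \<le> N (e - h)" if "h \<in> G" for h
  proof -
    have h: "g + \<delta> *\<^sub>R h \<in> G" using that g G' by (auto intro: subspace_add subspace_mul)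
    have "e - h = (1 / \<delta>) *\<^sub>R (x - (g + \<delta> *\<^sub>R h))"
      using \<delta> by (simp add: e_def algebra_simps)
    moreover have "x - (g + \<delta> *\<^sub>R h) \<in> X" using x h G' YD carrier_closed(2) by blast
    ultimately have "N (e - h) = N (x - (g + \<delta> *\<^sub>R h)) / \<delta>"
      using norm_scale[of "x - (g + \<delta> *\<^sub>R h)" "1 / \<delta>"] \<delta> by simp
    moreover have "\<delta> \<le> N (x - (g + \<delta> *\<^sub>R h))"
      using cINF_lower[OF bdd h] by (simp add: \<delta>_def)
    ultimately show ?thesis using \<delta> by simp
  qed
  obtain \<phi> where "linear \<phi>" "\<And>g. g \<in> G \<Longrightarrow> \<phi> g = 0" "\<phi> e = 1"
    "\<And>x. x \<in> X \<Longrightarrow> \<bar>\<phi> x\<bar> \<le> N x / 1"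
    using functional_vanishing_on[of G e 1] G' YD eY dist by (metis subset_trans subsetD zero_less_one)
  then show ?thesis using that eY Ne by simp
qed

end


section \<open>Banach subspaces and bounded operators\<close>

lemma banach_space_on_Sub:
  assumes X: "banach_space_on X N" and Y: "Y \<in> Sub X N"
  shows "banach_space_on Y N"
proof -
  have normed: "normed_space_on X N" using X by (simp add: banach_space_on_def)
  interpret normed_subspace X N by standard (rule normed)
  note YD = SubD[OF Y]
  have nY: "normed_space_on Y N" by (rule normed_subset[OF YD])
  interpret MX: Metric_space X "norm_dist X N" by (rule Metric_space_norm_dist[OF normed])
  interpret MY: Metric_space Y "norm_dist Y N" by (rule Metric_space_norm_dist[OF nY])
  have eq: "norm_dist Y N x y = norm_dist X N x y" if "x \<in> Y" "y \<in> Y" for x y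
    using that YD by (auto simp: norm_dist_def)
  have "MY.mcomplete"
    unfolding MY.mcomplete_def
  proof (intro allI impI)
    fix \<sigma> assume \<sigma>: "MY.MCauchy \<sigma>"
    then have ran: "range \<sigma> \<subseteq> Y" by (simp add: MY.MCauchy_def)
    then have inY: "\<sigma> n \<in> Y" for n by auto
    have "MX.MCauchy \<sigma>"
      using \<sigma> YD(2) inY by (auto simp: MY.MCauchy_def MX.MCauchy_def eq)
    then obtain l where l: "limitin MX.mtopology \<sigma> l sequentially"
      using X by (auto simp: banach_space_on_def MX.mcomplete_def)
    have "closedin MX.mtopology Y" using Y by (simp add: Sub_def norm_topology_def)
    then have "l \<in> Y" using l ran MX.metric_closedin_iff_sequentially_closed by blast
    then have "limitin MY.mtopology \<sigma> l sequentially"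
      using l inY eq[OF inY] unfolding MX.limit_metric_sequentially MY.limit_metric_sequentially
      by metis
    then show "\<exists>l. limitin MY.mtopology \<sigma> l sequentially" by blast
  qed
  then show ?thesis using nY by (simp add: banach_space_on_def)
qed

lemma approx_pair_Sub:
  assumes "banach_space_on X N" "Y \<in> Sub X N" "F \<in> fin_dim_subspaces Y"
  shows "approx_pair Y N F"
  using assms banach_space_on_Sub by (simp add: approx_pair_def)

lemma bounded_operator_linear:
  assumes "linear T" "\<And>x. x \<in> V \<Longrightarrow> T x \<in> W" "\<And>x. x \<in> V \<Longrightarrow> M (T x) \<le> C * N x"
  shows "bounded_operator V N W M T"
  using assms by (auto simp: bounded_operator_def linear_add linear_scale)

lemma bounded_operator_subset:
  assumes "bounded_operator V N W M T" "V' \<subseteq> V" "T ` V' \<subseteq> W'"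
  shows "bounded_operator V' N W' M T"
  using assms unfolding bounded_operator_def image_subset_iff Pi_iff by (meson subsetD)

lemma fin_dim_subspaces_image:
  assumes T: "bounded_operator V N W M T" and V: "subspace V" and F: "F \<in> fin_dim_subspaces V"
  shows "T ` F \<in> fin_dim_subspaces W"
proof -
  have add: "\<And>x y. x \<in> V \<Longrightarrow> y \<in> V \<Longrightarrow> T (x + y) = T x + T y"
    and TW: "\<And>x. x \<in> V \<Longrightarrow> T x \<in> W"
    and scale: "\<And>x c. x \<in> V \<Longrightarrow> T (c *\<^sub>R x) = c *\<^sub>R T x"
    using T by (auto simp: bounded_operator_def)
  have FD: "subspace F" "F \<subseteq> V" "finite_dim F" using F by (auto simp: fin_dim_subspaces_def)
  then have FV: "x \<in> F \<Longrightarrow> x \<in> V" for x by blast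
  have "T 0 = 0" using scale[of 0 0] subspace_0[OF V] by simp
  have "subspace (T ` F)"
    unfolding subspace_def
  proof (intro conjI ballI allI)
    show "0 \<in> T ` F" using \<open>T 0 = 0\<close> subspace_0[OF FD(1)] by (metis imageI)
  next
    fix u v assume "u \<in> T ` F" "v \<in> T ` F"
    then obtain x y where xy: "x \<in> F" "u = T x" "y \<in> F" "v = T y" by blast
    then have "u + v = T (x + y)" using add FV by simp
    then show "u + v \<in> T ` F" using xy subspace_add[OF FD(1)] by blast
  next
    fix c u assume "u \<in> T ` F"
    then obtain x where x: "x \<in> F" "u = T x" by blast
    then have "c *\<^sub>R u = T (c *\<^sub>R x)" using scale[OF FV] by simp
    then show "c *\<^sub>R u \<in> T ` F" using x subspace_mul[OF FD(1)] by blast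
  qed
  moreover have "T ` F \<subseteq> W" using TW FV by blast
  moreover have "finite_dim (T ` F)"
  proof -
    obtain B where B: "finite B" "B \<subseteq> F" "span B = F"
      using finite_dim_subspace_basis[OF FD(1,3)] by blast
    have "subspace {x \<in> F. T x \<in> span (T ` B)}"
      using FD(1) add scale FV \<open>T 0 = 0\<close>
      by (auto simp: subspace_def span_zero span_add span_scale)
    then have "span B \<subseteq> {x \<in> F. T x \<in> span (T ` B)}"
      using B(2) by (intro span_minimal) (auto intro: span_base)
    then show ?thesis using B by (auto simp: finite_dim_def intro!: exI[of _ "T ` B"])
  qed
  ultimately show ?thesis by (simp add: fin_dim_subspaces_def)
qed

lemma op_norm_le:
  assumes V: "normed_space_on V N"
    and T: "\<And>x. x \<in> V \<Longrightarrow> M (T x) \<le> C * N x" and C: "0 \<le> C"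
  shows "op_norm V N M T \<le> C"
  unfolding op_norm_def
proof (rule cSUP_least)
  show "V \<noteq> {}" using V subspace_0 by (auto simp: normed_space_on_def)
  fix x assume x: "x \<in> V"
  then have "0 \<le> N x" using V by (auto simp: normed_space_on_def)
  then show "M (T x) / N x \<le> C"
    using T[OF x] C by (cases "N x = 0") (auto simp: divide_le_eq)
qed

lemma le_op_norm:
  assumes V: "normed_space_on V N" and x: "x \<in> V"
    and T: "\<And>x. x \<in> V \<Longrightarrow> M (T x) \<le> C * N x" and T0: "M (T 0) = 0"
  shows "M (T x) \<le> op_norm V N M T * N x"
proof (cases "x = 0")
  case True
  have "N 0 = 0" using V subspace_0 by (auto simp: normed_space_on_def)
  then show ?thesis using True T0 by simp
next
  case False
  have pos: "0 < N y" if "y \<in> V" "y \<noteq> 0" for y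
    using V that by (auto simp: normed_space_on_def less_le)
  have "M (T y) / N y \<le> \<bar>C\<bar>" if y: "y \<in> V" for y
  proof (cases "y = 0")
    case False
    have "M (T y) \<le> \<bar>C\<bar> * N y"
      using T[OF y] pos[OF y False] mult_right_mono[of C "\<bar>C\<bar>" "N y"] by linarith
    then show ?thesis using pos[OF y False] by (simp add: divide_le_eq)
  qed (use T0 in simp)
  then have "bdd_above ((\<lambda>y. M (T y) / N y) ` V)" by (intro bdd_aboveI2)
  then have "M (T x) / N x \<le> op_norm V N M T"
    unfolding op_norm_def by (rule cSUP_upper[OF x])
  then show ?thesis using pos[OF x False] by (simp add: divide_le_eq)
qed


section \<open>Transferring a degree along a morphism\<close>

text \<open>The definition of a degree only asserts that some control function exists. Fixing one makes the
  bounds uniform: the same \<open>K\<close> serves all the morphisms below.\<close>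

locale controlled_degree =
  fixes d :: "'u::real_vector set \<Rightarrow> ('u \<Rightarrow> real) \<Rightarrow> 'u set \<Rightarrow> real"
    and K :: "real \<Rightarrow> real \<Rightarrow> real"
  assumes degree_nonneg: "approx_pair V N F \<Longrightarrow> 0 \<le> d V N F"
    and K_mono: "1 \<le> s \<Longrightarrow> s \<le> s' \<Longrightarrow> 0 \<le> t \<Longrightarrow> t \<le> t' \<Longrightarrow> K s t \<le> K s' t'"
    and K_tendsto: "0 \<le> t \<Longrightarrow> ((\<lambda>s. K s t) \<longlongrightarrow> t) (at 1 within {1..})"
    and degree_morphism:
      "morphism V N F W M G S T \<Longrightarrow> d W M G \<le> K (morphism_norm V N M G S T) (d V N F)"
begin

lemma K_near_1:
  assumes "0 \<le> t" "t < u"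
  obtains s where "1 < s" "K s t < u"
proof -
  have "\<forall>\<^sub>F s in at 1 within {1..}. K s t < u"
    using K_tendsto[OF assms(1)] assms(2) by (rule order_tendstoD)
  then have "\<forall>\<^sub>F s in at_right 1. K s t < u"
    by (rule filter_leD[rotated]) (rule at_le, auto)
  then obtain b where "1 < b" "\<forall>s>1. s < b \<longrightarrow> K s t < u"
    by (auto simp: eventually_at_right_field)
  then show ?thesis using that[of "(1 + b) / 2"] by auto
qed

lemma K_1_le:
  assumes t: "0 \<le> t"
  shows "K 1 t \<le> t"
proof (rule dense_ge)
  fix u assume "t < u"
  then obtain s where "1 < s" "K s t < u" using K_near_1[OF t] by blast
  then show "K 1 t \<le> u" using K_mono[of 1 s t t] t by simp
qed

text \<open>\<open>K\<close> is only controlled on \<open>[1, \<infinity>)\<close>, so the norm of the morphism must be at least \<open>1\<close> before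
  monotonicity applies; it is, because \<open>T \<circ> S\<close> fixes every nonzero vector of \<open>G\<close>.\<close>

lemma degree_transfer:
  assumes VF: "approx_pair V N F" and WG: "approx_pair W M G"
    and S: "bounded_operator G M F N S" and T: "bounded_operator V N W M T"
    and TS: "\<And>g. g \<in> G \<Longrightarrow> T (S g) = g"
    and A: "\<And>x. x \<in> V \<Longrightarrow> M (T x) \<le> A * N x" and B: "\<And>g. g \<in> G \<Longrightarrow> N (S g) \<le> B * M g"
    and nonneg: "0 \<le> A" "0 \<le> B" and s: "1 \<le> s" "A * B \<le> s" and t: "d V N F \<le> t"
  shows "d W M G \<le> K s t"
proof -
  have mor: "morphism V N F W M G S T"
    using assms by (simp add: morphism_def)
  have nV: "normed_space_on V N" and F: "F \<subseteq> V"
    using VF by (auto simp: approx_pair_def banach_space_on_def fin_dim_subspaces_def)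
  have nW: "normed_space_on W M" and G: "subspace G" "G \<subseteq> W"
    using WG by (auto simp: approx_pair_def banach_space_on_def fin_dim_subspaces_def)
  interpret V: normed_subspace V N by standard (rule nV)
  interpret W: normed_subspace W M by standard (rule nW)
  have nG: "normed_space_on G M" by (rule W.normed_subset[OF G])
  have mn: "1 \<le> morphism_norm V N M G S T \<and> morphism_norm V N M G S T \<le> s"
  proof (cases "G = {0}")
    case True
    then show ?thesis using s by (simp add: morphism_norm_def)
  next
    case False
    then obtain g where g: "g \<in> G" "g \<noteq> 0" using subspace_0[OF G(1)] by blast
    have lin0: "T 0 = 0" "S 0 = 0"
      using S T subspace_0[OF G(1)] V.carrier_closed(4)
      unfolding bounded_operator_def by (metis scaleR_zero_left)+
    have Sg: "S g \<in> V" using S g F by (auto simp: bounded_operator_def)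
    have pos: "0 < M g" using g G W.norm_nonneg[of g] W.norm_eq_0[of g] by (auto simp: less_le)
    have zero: "M 0 = 0" "N 0 = 0"
      using W.norm_eq_0[OF W.carrier_closed(4)] V.norm_eq_0[OF V.carrier_closed(4)] by auto
    have leS: "N (S g) \<le> op_norm G M N S * M g"
      by (rule le_op_norm[where T = S, OF nG g(1) B]) (use lin0 zero in auto)
    have leT: "M g \<le> op_norm V N M T * N (S g)"
      using le_op_norm[where T = T and M = M, OF nV Sg A] lin0 zero TS[OF g(1)] by simp
    have "0 < op_norm V N M T"
      using leT pos V.norm_nonneg[OF Sg] by (smt (verit) mult_nonpos_nonneg)
    then have "M g \<le> op_norm V N M T * (op_norm G M N S * M g)"
      using leT leS by (smt (verit) mult_left_mono)
    then have "1 \<le> op_norm G M N S * op_norm V N M T"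
      using pos by (simp add: mult.commute mult.left_commute)
    moreover have "op_norm G M N S * op_norm V N M T \<le> B * A"
    proof (rule mult_mono)
      show "op_norm G M N S \<le> B" by (rule op_norm_le[where T = S, OF nG B nonneg(2)])
      show "op_norm V N M T \<le> A" by (rule op_norm_le[where T = T, OF nV A nonneg(1)])
    qed (use nonneg \<open>0 < op_norm V N M T\<close> in auto)
    ultimately show ?thesis using False s by (simp add: morphism_norm_def mult.commute)
  qed
  have "d W M G \<le> K (morphism_norm V N M G S T) (d V N F)" by (rule degree_morphism[OF mor])
  also have "\<dots> \<le> K s t" using mn t degree_nonneg[OF VF] by (intro K_mono) auto
  finally show ?thesis .
qed

text \<open>The inclusions of \<open>G\<close> into \<open>F\<close> and of \<open>Z\<close> into \<open>Y\<close> form a morphism of norm \<open>1\<close>.\<close>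

lemma degree_antimono_space:
  assumes X: "banach_space_on X N" and Y: "Y \<in> Sub X N" and Z: "Z \<in> Sub X N" "Z \<subseteq> Y"
    and F: "F \<in> fin_dim_subspaces Z" "G \<in> fin_dim_subspaces Z" "G \<subseteq> F"
  shows "d Y N G \<le> d Z N F"
proof -
  have ap: "approx_pair Z N F" by (rule approx_pair_Sub[OF X Z(1) F(1)])
  have "G \<in> fin_dim_subspaces Y" using F Z by (auto simp: fin_dim_subspaces_def)
  then have aq: "approx_pair Y N G" by (rule approx_pair_Sub[OF X Y])
  have "d Y N G \<le> K 1 (d Z N F)"
    by (rule degree_transfer[OF ap aq, of "\<lambda>x. x" "\<lambda>x. x" 1 1])
      (use F Z in \<open>auto intro!: bounded_operator_linear[of _ _ _ _ 1] linear_ident\<close>)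
  also have "\<dots> \<le> d Z N F" by (rule K_1_le[OF degree_nonneg[OF ap]])
  finally show ?thesis .
qed

lemma finite_dim_small:
  assumes "banach_space_on X N" "Y \<in> Sub X N" "finite_dim Y"
  shows "d_small d Y N"
proof -
  have "subspace Y" using assms(2) by (simp add: Sub_def)
  then have Y: "Y \<in> fin_dim_subspaces Y" using assms(3) by (simp add: fin_dim_subspaces_def)
  have "d Y N G \<le> d Y N Y" if "G \<in> fin_dim_subspaces Y" for G
    using degree_antimono_space[OF assms(1,2,2) subset_refl Y that] that
    by (simp add: fin_dim_subspaces_def)
  then show ?thesis unfolding d_small_def by (intro bdd_aboveI2)
qed


section \<open>Openness in the Ellentuck topology\<close>

text \<open>If \<open>F\<close> witnesses that the degree of \<open>Y\<close> exceeds \<open>c\<close>, it does so as well in every \<open>Z'\<close> between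
  \<open>F\<close> and \<open>Y\<close>, and an isomorphism of \<open>Z'\<close> close enough to the identity moves \<open>F\<close> to a witness for
  the image. The bound \<open>\<epsilon> = (s - 1) / (s + 1)\<close> is the one with \<open>(1 + \<epsilon>) / (1 - \<epsilon>) = s\<close>.\<close>

lemma ellentuck_nbhd_degree:
  assumes X: "banach_space_on X N" and Y: "Y \<in> Sub X N" and F: "F \<in> fin_dim_subspaces Y"
    and c: "0 \<le> c" "c < d Y N F"
  obtains \<epsilon> where "\<epsilon> > 0"
    "\<And>Z. Z \<in> ellentuck_nbhd X N F Y \<epsilon> \<Longrightarrow> \<exists>G\<in>fin_dim_subspaces Z. c < d Z N G"
proof -
  interpret normed_subspace X N by standard (use X in \<open>simp add: banach_space_on_def\<close>)
  obtain s where s: "1 < s" "K s c < d Y N F" using K_near_1[OF c] by blast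
  define \<epsilon> where "\<epsilon> = (s - 1) / (s + 1)"
  have \<epsilon>: "0 < \<epsilon>" "\<epsilon> < 1" and s_eq: "(1 + \<epsilon>) / (1 - \<epsilon>) = s"
    using s by (auto simp: \<epsilon>_def field_simps)
  show ?thesis
  proof (rule that[OF \<epsilon>(1)])
    fix Z assume "Z \<in> ellentuck_nbhd X N F Y \<epsilon>"
    then obtain Z' T where Z: "Z \<in> Sub X N" and Z': "Z' \<in> Sub X N" "F \<subseteq> Z'" "Z' \<subseteq> Y"
      and T: "isomorphism Z' N Z N T" and near: "op_norm Z' N N (\<lambda>x. T x - x) < \<epsilon>"
      by (auto simp: ellentuck_nbhd_def)
    define R where "R = inv_into Z' T"
    have bij: "bij_betw T Z' Z" and bT: "bounded_operator Z' N Z N T"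
      and bR: "bounded_operator Z N Z' N R"
      using T by (auto simp: isomorphism_def R_def)
    note Z'D = SubD[OF Z'(1)] and ZD = SubD[OF Z]
    have nZ': "normed_space_on Z' N" by (rule normed_subset[OF Z'D])
    have F': "F \<in> fin_dim_subspaces Z'" using F Z' by (auto simp: fin_dim_subspaces_def)
    have TZ: "T x \<in> Z" if "x \<in> Z'" for x using bT that by (auto simp: bounded_operator_def)
    have RT: "R (T x) = x" if "x \<in> Z'" for x
      using bij that by (simp add: R_def bij_betw_inv_into_left)
    have RZ: "R z \<in> Z'" and TR: "T (R z) = z" if "z \<in> Z" for z
      using bij that bij_betw_inv_into_right[OF bij that] bij_betwE[OF bij_betw_inv_into[OF bij]]
      by (auto simp: R_def)
    have inX: "x \<in> X" "T x \<in> X" if "x \<in> Z'" for x using that TZ Z'D ZD by auto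
    obtain C where C: "\<And>x. x \<in> Z' \<Longrightarrow> N (T x) \<le> C * N x"
      using bT unfolding bounded_operator_def by blast
    have diff: "N (T x - x) \<le> (C + 1) * N x" if "x \<in> Z'" for x
      using norm_diff[OF inX(2)[OF that] inX(1)[OF that]] C[OF that] by (simp add: algebra_simps)
    have T0: "T 0 = 0"
      using bT subspace_0[OF Z'D(1)] unfolding bounded_operator_def by (metis scaleR_zero_left)
    have close: "N (T x - x) \<le> \<epsilon> * N x" if x: "x \<in> Z'" for x
    proof -
      have "N (T x - x) \<le> op_norm Z' N N (\<lambda>x. T x - x) * N x"
        by (rule le_op_norm[where T = "\<lambda>x. T x - x", OF nZ' x diff]) (use T0 norm_eq_0[OF carrier_closed(4)] in auto)
      also have "\<dots> \<le> \<epsilon> * N x"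
        using near norm_nonneg[OF inX(1)[OF x]] by (intro mult_right_mono) auto
      finally show ?thesis .
    qed
    have up: "N (T x) \<le> (1 + \<epsilon>) * N x" if x: "x \<in> Z'" for x
      using norm_add[OF carrier_closed(2)[OF inX(2)[OF x] inX(1)[OF x]] inX(1)[OF x]] close[OF x]
      by (simp add: algebra_simps)
    have low: "N x \<le> 1 / (1 - \<epsilon>) * N (T x)" if x: "x \<in> Z'" for x
    proof -
      have "N x \<le> N (T x) + N (T x - x)"
        using norm_diff[OF inX(2)[OF x] carrier_closed(2)[OF inX(2)[OF x] inX(1)[OF x]]] by simp
      then have "(1 - \<epsilon>) * N x \<le> N (T x)" using close[OF x] by (simp add: algebra_simps)
      then show ?thesis using \<epsilon> by (simp add: field_simps)
    qed
    have G: "T ` F \<in> fin_dim_subspaces Z"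
      by (rule fin_dim_subspaces_image[OF bT Z'D(1) F'])
    have "c < d Z N (T ` F)"
    proof (rule ccontr)
      assume "\<not> c < d Z N (T ` F)"
      then have small: "d Z N (T ` F) \<le> c" by simp
      have "d Z' N F \<le> K s c"
      proof (rule degree_transfer[OF approx_pair_Sub[OF X Z G] approx_pair_Sub[OF X Z'(1) F']])
        show "bounded_operator F N (T ` F) N T"
          by (rule bounded_operator_subset[OF bT Z'(2)]) simp
        show "bounded_operator Z N Z' N R" by (rule bR)
        show "R (T g) = g" if "g \<in> F" for g using that Z'(2) RT by blast
        show "N (R z) \<le> 1 / (1 - \<epsilon>) * N z" if "z \<in> Z" for z
          using low[OF RZ[OF that]] TR[OF that] by simp
        show "N (T g) \<le> (1 + \<epsilon>) * N g" if "g \<in> F" for g using that Z'(2) up by blast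
        show "1 / (1 - \<epsilon>) * (1 + \<epsilon>) \<le> s" using s_eq by simp
      qed (use \<epsilon> s small in auto)
      moreover have "d Y N F \<le> d Z' N F"
        by (rule degree_antimono_space[OF X Y Z'(1,3) F' F']) simp
      ultimately show False using s(2) by simp
    qed
    then show "\<exists>G\<in>fin_dim_subspaces Z. c < d Z N G" using G by blast
  qed
qed

text \<open>The identity map of \<open>Y\<close> is the required isomorphism.\<close>

lemma mem_ellentuck_nbhd:
  assumes "normed_space_on X N" "Y \<in> Sub X N" "F \<in> fin_dim_subspaces Y" "\<epsilon> > 0"
  shows "Y \<in> ellentuck_nbhd X N F Y \<epsilon>"
proof -
  interpret normed_subspace X N by standard (rule assms)
  note YD = SubD[OF assms(2)]
  have inv: "inv_into Y (\<lambda>x. x) x = x" if "x \<in> Y" for x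
    using inv_into_f_f[of "\<lambda>x. x" Y x] that by (simp add: inj_on_def)
  have "bounded_operator Y N Y N (\<lambda>x. x)"
    by (rule bounded_operator_linear[of _ _ _ _ 1]) (auto intro: linear_ident)
  moreover have "bounded_operator Y N Y N (inv_into Y (\<lambda>x. x))"
    using YD(1) by (auto simp: bounded_operator_def inv subspace_add subspace_mul intro!: exI[of _ 1])
  ultimately have "isomorphism Y N Y N (\<lambda>x. x)"
    by (simp add: isomorphism_def bij_betw_def inj_on_def)
  moreover have le0: "op_norm Y N N (\<lambda>x. x - x) \<le> 0"
    by (rule op_norm_le[OF normed_subset[OF YD]]) (use norm_eq_0[OF carrier_closed(4)] in auto)
  moreover have "op_norm Y N N (\<lambda>x. x - x) < \<epsilon>" using le0 assms(4) by linarith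
  moreover have "F \<subseteq> Y" using assms(3) by (simp add: fin_dim_subspaces_def)
  ultimately show ?thesis using assms(2) unfolding ellentuck_nbhd_def by blast
qed

lemma openin_degree_gt:
  assumes X: "banach_space_on X N" and c: "0 \<le> c"
  shows "openin (ellentuck_topology X N)
    {Y \<in> Sub X N. \<exists>F\<in>fin_dim_subspaces Y. c < d Y N F}" (is "openin _ ?U")
proof (subst openin_subopen, intro ballI)
  fix Y assume "Y \<in> ?U"
  then obtain F where Y: "Y \<in> Sub X N" and F: "F \<in> fin_dim_subspaces Y" "c < d Y N F" by blast
  obtain \<epsilon> where \<epsilon>: "\<epsilon> > 0"
    "\<And>Z. Z \<in> ellentuck_nbhd X N F Y \<epsilon> \<Longrightarrow> \<exists>G\<in>fin_dim_subspaces Z. c < d Z N G"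
    using ellentuck_nbhd_degree[OF X Y F(1) c F(2)] by blast
  have "openin (ellentuck_topology X N) (ellentuck_nbhd X N F Y \<epsilon>)"
    unfolding ellentuck_topology_def
    by (rule topology_generated_by_Basis) (use Y F \<epsilon> in blast)
  moreover have "Y \<in> ellentuck_nbhd X N F Y \<epsilon>"
    using mem_ellentuck_nbhd X Y F \<epsilon> by (auto simp: banach_space_on_def)
  moreover have "ellentuck_nbhd X N F Y \<epsilon> \<subseteq> ?U"
    using \<epsilon>(2) by (auto simp: ellentuck_nbhd_def)
  ultimately show "\<exists>T. openin (ellentuck_topology X N) T \<and> Y \<in> T \<and> T \<subseteq> ?U" by blast
qed

lemma gdelta_large:
  assumes X: "banach_space_on X N"
  shows "gdelta_in (ellentuck_topology X N) {Y \<in> Sub X N. d_large d Y N}"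
proof -
  define U where "U = (\<lambda>n::nat. {Y \<in> Sub X N. \<exists>F\<in>fin_dim_subspaces Y. real n < d Y N F})"
  have "{Y \<in> Sub X N. d_large d Y N} = \<Inter> (range U)"
  proof (intro equalityI subsetI)
    fix Y assume "Y \<in> {Y \<in> Sub X N. d_large d Y N}"
    then show "Y \<in> \<Inter> (range U)"
      by (auto simp: U_def d_small_def bdd_above_def not_le)
  next
    fix Y assume "Y \<in> \<Inter> (range U)"
    then have Y: "Y \<in> Sub X N" and gt: "\<exists>F\<in>fin_dim_subspaces Y. real n < d Y N F" for n
      by (auto simp: U_def)
    have "\<not> (\<forall>F\<in>fin_dim_subspaces Y. d Y N F \<le> c)" for c
    proof -
      obtain n where "c \<le> real n" using real_arch_simple by blast
      then show ?thesis using gt[of n] by force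
    qed
    then show "Y \<in> {Y \<in> Sub X N. d_large d Y N}"
      using Y by (auto simp: d_small_def bdd_above_def)
  qed
  moreover have "gdelta_in (ellentuck_topology X N) (\<Inter> (range U))"
    using openin_degree_gt[OF X]
    by (intro gdelta_in_Inter) (auto simp: U_def intro!: open_imp_gdelta_in)
  ultimately show ?thesis by simp
qed


section \<open>Invariance under finite-dimensional sums\<close>

text \<open>The coordinate functional \<open>a\<close> along \<open>f\<close> and the projection \<open>P\<close> onto \<open>Y\<close> are bounded because
  \<open>f\<close> has positive distance from \<open>Y\<close>. The bounds \<open>D\<close>, \<open>A\<close> and \<open>B\<close> on the maps that make up the two
  morphisms involve only \<open>f\<close> and \<open>Y\<close>, so one value of \<open>K\<close> bounds the degree for all
  finite-dimensional subspaces at once.\<close>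

lemma small_iff_small_add_line:
  assumes X: "banach_space_on X N" and Y: "Y \<in> Sub X N" "\<not> finite_dim Y"
    and f: "f \<in> X" "f \<notin> Y"
  shows "d_small d (Y + span {f}) N \<longleftrightarrow> d_small d Y N"
proof -
  interpret normed_subspace X N by standard (use X in \<open>simp add: banach_space_on_def\<close>)
  define W where "W = Y + span {f}"
  have W: "W \<in> Sub X N" unfolding W_def by (rule Sub_add_line[OF Y(1) f])
  note YD = SubD[OF Y(1)] and WD = SubD[OF W]
  have memW: "w \<in> W \<longleftrightarrow> (\<exists>y\<in>Y. \<exists>t. w = y + t *\<^sub>R f)" for w
    unfolding W_def by (rule mem_add_line)
  have YW: "Y \<subseteq> W" unfolding memW subset_iff by (metis add.right_neutral scaleR_zero_left)
  obtain a C where a: "linear a" "\<And>y. y \<in> Y \<Longrightarrow> a y = 0" "a f = 1"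
    "0 \<le> C" "\<And>x. x \<in> X \<Longrightarrow> \<bar>a x\<bar> \<le> C * N x"
    using coordinate_functional[OF Y(1) f] by blast
  have Nf: "0 \<le> N f" by (rule norm_nonneg[OF f(1)])
  define P where "P = (\<lambda>x. x - a x *\<^sub>R f)"
  define D where "D = 1 + C * N f"
  have D: "0 \<le> D" using a Nf by (simp add: D_def)
  have linP: "linear P"
    using a(1) by (auto intro!: linearI simp: P_def linear_add linear_scale algebra_simps)
  have PY: "P w \<in> Y" if "w \<in> W" for w
    using that a by (auto simp: memW P_def linear_add linear_scale)
  have P_id: "P y = y" if "y \<in> Y" for y using a that by (simp add: P_def)
  have PN: "N (P x) \<le> D * N x" if "x \<in> X" for x
    unfolding P_def D_def by (rule norm_coordinate_projection_le[OF f(1) that a(5)[OF that]])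
  have bP: "bounded_operator W N Y N P"
    using linP PY PN WD by (intro bounded_operator_linear) auto
  have down: "d_small d Y N" if small: "d_small d W N"
  proof -
    obtain c where c: "\<And>G. G \<in> fin_dim_subspaces W \<Longrightarrow> d W N G \<le> c"
      using small by (auto simp: d_small_def bdd_above_def)
    have "d Y N G \<le> K (max 1 D) c" if G: "G \<in> fin_dim_subspaces Y" for G
    proof -
      have G': "G \<in> fin_dim_subspaces W" "G \<subseteq> Y" using G YW by (auto simp: fin_dim_subspaces_def)
      show ?thesis
      proof (rule degree_transfer[OF approx_pair_Sub[OF X W G'(1)] approx_pair_Sub[OF X Y(1) G]])
        show "bounded_operator G N G N (\<lambda>x. x)"
          by (rule bounded_operator_linear[of _ _ _ _ 1]) (auto intro: linear_ident)
        show "N (P x) \<le> D * N x" if "x \<in> W" for x using that PN WD by blast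
        show "N g \<le> 1 * N g" for g by simp
        show "P g = g" if "g \<in> G" for g using that G' P_id by blast
      qed (use bP D c G' in auto)
    qed
    then show ?thesis unfolding d_small_def by (intro bdd_aboveI2)
  qed
  define A where "A = 3 + N f"
  define B where "B = D + 2 * C"
  have AB: "0 \<le> A" "0 \<le> B" using Nf D a by (auto simp: A_def B_def)
  have up: "d_small d W N" if small: "d_small d Y N"
  proof -
    obtain c where c: "\<And>G. G \<in> fin_dim_subspaces Y \<Longrightarrow> d Y N G \<le> c"
      using small by (auto simp: d_small_def bdd_above_def)
    have "d W N G \<le> K (max 1 (A * B)) c" if G: "G \<in> fin_dim_subspaces W" for G
    proof -
      have GW: "G \<subseteq> W" using G by (simp add: fin_dim_subspaces_def)
      have "P ` G \<in> fin_dim_subspaces Y" by (rule fin_dim_subspaces_image[OF bP WD(1) G])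
      then obtain e \<phi> where e: "e \<in> Y" "N e \<le> 2" and \<phi>: "linear \<phi>" "\<And>g. g \<in> P ` G \<Longrightarrow> \<phi> g = 0"
        "\<phi> e = 1" "\<And>x. x \<in> X \<Longrightarrow> \<bar>\<phi> x\<bar> \<le> N x"
        using riesz_functional[OF Y] by blast
      have eX: "e \<in> X" using e YD by blast
      \<comment> \<open>\<open>S\<close> replaces the coordinate direction \<open>f\<close> by \<open>e\<close>, and \<open>T\<close> turns \<open>e\<close> back into \<open>f\<close> while
        fixing the projection of \<open>G\<close> to \<open>Y\<close>.\<close>
      define S where "S = (\<lambda>w. P w + a w *\<^sub>R e)"
      define T where "T = (\<lambda>y. y + \<phi> y *\<^sub>R (f - e))"
      have linS: "linear S" and linT: "linear T"
        using a(1) \<phi>(1) linP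
        by (auto intro!: linearI simp: S_def T_def linear_add linear_scale algebra_simps)
      have SN: "N (S w) \<le> B * N w" if w: "w \<in> W" for w
      proof -
        have wX: "w \<in> X" "P w \<in> X" using w WD PY[OF w] YD by auto
        have "N (S w) \<le> N (P w) + \<bar>a w\<bar> * N e"
          unfolding S_def using norm_add[OF wX(2) carrier_closed(3)[OF eX]] norm_scale[OF eX] by metis
        also have "\<dots> \<le> D * N w + (C * N w) * 2"
          using PN[OF wX(1)] a(5)[OF wX(1)] e(2) norm_nonneg[OF eX] norm_nonneg[OF wX(1)] a(4)
          by (intro add_mono mult_mono) auto
        finally show ?thesis by (simp add: B_def algebra_simps)
      qed
      have TN: "N (T y) \<le> A * N y" if y: "y \<in> Y" for y
      proof -
        have yX: "y \<in> X" using y YD by blast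
        have fe: "f - e \<in> X" by (rule carrier_closed(2)[OF f(1) eX])
        have "N (f - e) \<le> N f + 2" using norm_diff[OF f(1) eX] e(2) by simp
        have "N (T y) \<le> N y + \<bar>\<phi> y\<bar> * N (f - e)"
          unfolding T_def using norm_add[OF yX carrier_closed(3)[OF fe]] norm_scale[OF fe] by metis
        also have "\<dots> \<le> N y + N y * (N f + 2)"
          using \<phi>(4)[OF yX] \<open>N (f - e) \<le> N f + 2\<close> norm_nonneg[OF fe] norm_nonneg[OF yX]
          by (intro add_left_mono mult_mono) auto
        finally show ?thesis by (simp add: A_def algebra_simps)
      qed
      have SY: "S w \<in> Y" if "w \<in> W" for w
        unfolding S_def using PY[OF that] e(1) YD(1) by (intro subspace_add subspace_mul)
      have TW: "T y \<in> W" if y: "y \<in> Y" for y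
      proof -
        have "T y = (y - \<phi> y *\<^sub>R e) + \<phi> y *\<^sub>R f" by (simp add: T_def algebra_simps)
        moreover have "y - \<phi> y *\<^sub>R e \<in> Y"
          using y e(1) YD(1) by (intro subspace_diff subspace_mul)
        ultimately show ?thesis unfolding memW by blast
      qed
      have TS: "T (S g) = g" if g: "g \<in> G" for g
      proof -
        have "\<phi> (S g) = a g" using \<phi> g by (simp add: S_def linear_add linear_scale)
        then show ?thesis by (simp add: T_def S_def P_def algebra_simps)
      qed
      have bS: "bounded_operator W N Y N S"
        using linS SY SN by (rule bounded_operator_linear)
      have SG: "S ` G \<in> fin_dim_subspaces Y" by (rule fin_dim_subspaces_image[OF bS WD(1) G])
      show ?thesis
      proof (rule degree_transfer[OF approx_pair_Sub[OF X Y(1) SG] approx_pair_Sub[OF X W G]])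
        show "bounded_operator G N (S ` G) N S"
          by (rule bounded_operator_subset[OF bS GW]) simp
        show "bounded_operator Y N W N T"
          using linT TW TN by (rule bounded_operator_linear)
        show "N (S g) \<le> B * N g" if "g \<in> G" for g using that GW SN by blast
      qed (use TS TN AB c[OF SG] in auto)
    qed
    then show ?thesis unfolding d_small_def by (intro bdd_aboveI2)
  qed
  show ?thesis using up down by (auto simp: W_def)
qed

lemma small_iff_small_add_finite_dim:
  assumes X: "banach_space_on X N" and Y: "Y \<in> Sub X N" "\<not> finite_dim Y"
    and F: "F \<in> fin_dim_subspaces X"
  shows "d_small d (Y + F) N \<longleftrightarrow> d_small d Y N"
proof -
  interpret normed_subspace X N by standard (use X in \<open>simp add: banach_space_on_def\<close>)
  define Q where "Q = (\<lambda>W. W \<in> Sub X N \<and> \<not> finite_dim W \<and> (d_small d W N \<longleftrightarrow> d_small d Y N))"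
  have "Q (Y + F)"
    using F SubD(1)[OF Y(1)]
  proof (induction rule: add_finite_dim_induct)
    case (subspace W)
    then show ?case using SubD by (auto simp: Q_def)
  next
    case base
    then show ?case using Y by (simp add: Q_def)
  next
    case (line W f)
    then have W: "W \<in> Sub X N" "\<not> finite_dim W" "d_small d W N \<longleftrightarrow> d_small d Y N"
      by (auto simp: Q_def)
    have "W \<subseteq> W + span {f}"
      unfolding mem_add_line subset_iff by (metis add.right_neutral scaleR_zero_left)
    then have "\<not> finite_dim (W + span {f})" using W(2) finite_dim_mono by blast
    then show ?case
      using W small_iff_small_add_line[OF X W(1,2)] Sub_add_line[OF W(1)] line by (simp add: Q_def)
  qed
  then show ?thesis by (simp add: Q_def)
qed

end

theorem proposition3p25:
  fixes d :: "'u::real_vector set \<Rightarrow> ('u \<Rightarrow> real) \<Rightarrow> 'u set \<Rightarrow> real"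
    and X :: "'u set" and N :: "'u \<Rightarrow> real"
  assumes "is_degree d"
    and "banach_space_on X N"
    and "\<not> finite_dim X"
  shows "D_family X N {Y \<in> Sub X N. d_large d Y N}"
proof -
  obtain K where K: "\<forall>s\<ge>1. \<forall>s'\<ge>s. \<forall>t\<ge>0. \<forall>t'\<ge>t. K s t \<le> K s' t'"
    "\<forall>t\<ge>0. ((\<lambda>s. K s t) \<longlongrightarrow> t) (at 1 within {1..})"
    "\<forall>V N F W M G S T. morphism V N F W M G S T \<longrightarrow>
       d W M G \<le> K (morphism_norm V N M G S T) (d V N F)"
    using assms(1) unfolding is_degree_def by (elim conjE exE) (rule that)
  have d: "\<forall>V N F. approx_pair V N F \<longrightarrow> 0 \<le> d V N F"
    using assms(1) by (simp add: is_degree_def)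
  interpret controlled_degree d K
  proof
    show "0 \<le> d V N F" if "approx_pair V N F" for V N F using d that by blast
    show "K s t \<le> K s' t'" if "1 \<le> s" "s \<le> s'" "0 \<le> t" "t \<le> t'" for s s' t t'
      using K(1) that by blast
    show "((\<lambda>s. K s t) \<longlongrightarrow> t) (at 1 within {1..})" if "0 \<le> t" for t using K(2) that by blast
    show "d W M G \<le> K (morphism_norm V N M G S T) (d V N F)" if "morphism V N F W M G S T"
      for V N F W M G S T using K(3) that by blast
  qed
  interpret normed_subspace X N by standard (use assms(2) in \<open>simp add: banach_space_on_def\<close>)
  have "{Y \<in> Sub X N. d_large d Y N} \<subseteq> {Y \<in> Sub X N. \<not> finite_dim Y}"
    using finite_dim_small[OF assms(2)] by blast
  then show ?thesis
    using gdelta_large[OF assms(2)] small_iff_small_add_finite_dim[OF assms(2)] Sub_add_finite_dim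
    by (auto simp: D_family_def)
qed

end
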